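(* Let $\mathbb{S}^*=\{\gamma^*\in\mathbb{S}:\gamma^*\text{ is a stationary point of the switching fluid model}\}$. Then $\mathbb{S}^*=\{x_0^*\}$, where $$x_0^*=(q_1^*,q_2^*,z_{1,1}^*,z_{1,2}^*,z_{2,1}^*,z_{2,2}^* )=(0,0,\lambda,0,0,\lambda);$$ i.e., $x_0^*$ is the unique stationary point of the switching fluid model.
   Context: Parameters (symmetric X model): $0<\lambda<1$, $0<\mu<1$, $\theta>0$, $\kappa>0$, $\tau>0$, with the standing assumptions $\lambda\le 1-\tau$ and $\theta<\mu$. Service rates are $\mu_{1,1}=\mu_{2,2}=1$, $\mu_{1,2}=\mu_{2,1}=\mu$; each of the two service pools has capacity $1$. State: $x=(q_1,q_2,z_{1,1},z_{1,2},z_{2,1},z_{2,2})\in\mathbb{S}=[0,\lambda/\theta]^2\times[0,1]^4$, where $q_i$ is the class-$i$ queue content and $z_{i,j}$ is the class-$i$ fluid in service in pool $j$, with $z_{1,1}+z_{2,1}\le1$, $z_{1,2}+z_{2,2}\le 1$ (pool $j$ is full if equality holds). Put $d_{1,2}=q_1-q_2-\kappa$, $d_{2,1}=q_2-q_1-\kappa$, and let the sliding manifold $\mathbb{S}_{i,j}$ be the set of $x\in\mathbb{S}$ with $d_{i,j}=0$ and both pools full. Switching fluid model (fluid version of the FQR-ART control): $x$ is continuous and almost everywhere differentiable. Class-$i$ fluid arrives at rate $\lambda$, abandons queue $i$ at rate $\theta q_i$, and leaves service in pool $j$ at rate $\mu_{i,j}z_{i,j}$. A pool never idles while its own queue is positive.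 Released capacity is assigned as follows, for $(i,j)=(1,2)$ and $(i,j)=(2,1)$. (1) Active sharing: if both pools are full, $d_{i,j}>0$ and $z_{j,i}\le\tau$, both pools take new fluid only from queue $i$: $\dot q_i=\lambda-\theta q_i-(z_{1,1}+\mu z_{2,1}+\mu z_{1,2}+z_{2,2})$, $\dot q_j=\lambda-\theta q_j$, $\dot z_{j,j}=-z_{j,j}$, $z_{i,j}=1-z_{j,j}$, $\dot z_{j,i}=-\mu z_{j,i}$, $z_{i,i}=1-z_{j,i}$. (2) No active sharing: if both pools are full and, for each of the two pairs $(i,j)$, $d_{i,j}<0$ or $z_{j,i}>\tau$, each pool takes fluid only from its own queue: $\dot q_i=\lambda-\theta q_i-z_{i,i}-\mu z_{j,i}$, $\dot z_{j,i}=-\mu z_{j,i}$, $z_{i,i}=1-z_{j,i}$ (while $q_i>0$). (3) Sliding: if $x\in\mathbb{S}_{i,j}$ and $z_{j,i}\le\tau$, pool $i$ takes only class-$i$ fluid and pool $j$ splits its released capacity between queues $i$ and $j$ so that $d_{i,j}=0$ is maintained, when this is possible. (4) When $q_i=0$ and pool $i$ can absorb all arriving class-$i$ fluid, that fluid enters pool $i$ immediately; without sharing, if pool $i$ is not full, $\dot z_{i,i}=\lambda-z_{i,i}$ and $\dot z_{j,i}=-\mu z_{j,i}$. (5) Spare capacity: if pool $j$ is not full and $q_i\ge\kappa$, pool $j$ also accepts class-$i$ fluid regardless of the value of $z_{j,i}$, but class $j$ has strict priority in pool $j$ whenever $z_{j,i}>\tau$. A point $x^*\in\mathbb{S}$ is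 stationary if $x(0)=x^*$ implies $x(t)=x^*$ for all $t\ge0$.
   Formalization: Trajectories are required to be integrals of their a.e. derivative (not merely continuous and a.e. differentiable), and a stationary point must admit at least one trajectory; otherwise Cantor-type perturbations leave x_0^*, and states with no trajectory are vacuously stationary. *)

theory Defs
  imports "HOL-Analysis.Analysis"
begin

text \<open>A state is a pair \<open>(q, z)\<close>: \<open>q $ i\<close> is the content of queue \<open>i\<close>, and \<open>z $ i $ j\<close> is
  the class-\<open>i\<close> fluid in service in pool \<open>j\<close>. Classes and pools are indexed by the two-element
  type \<open>2\<close>, so a pair \<open>i \<noteq> j\<close> is either \<open>(1,2)\<close> or \<open>(2,1)\<close>.\<close>

type_synonym state = "(real^2) \<times> (real^2^2)"

abbreviation queue :: "state \<Rightarrow> 2 \<Rightarrow> real" where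
  "queue x i \<equiv> fst x $ i"

abbreviation served :: "state \<Rightarrow> 2 \<Rightarrow> 2 \<Rightarrow> real" where
  "served x i j \<equiv> snd x $ i $ j"

definition pool_full :: "state \<Rightarrow> 2 \<Rightarrow> bool" where
  "pool_full x j \<longleftrightarrow> (\<Sum>i\<in>UNIV. served x i j) = 1"

text \<open>The locale only fixes the parameters; it makes no assumptions on them.\<close>

locale switching_fluid =
  fixes lam \<mu> \<theta> \<kappa> \<tau> :: real
begin

definition state_space :: "state set" where
  "state_space = {x. (\<forall>i. 0 \<le> queue x i \<and> queue x i \<le> lam / \<theta>) \<and>
                     (\<forall>i j. 0 \<le> served x i j \<and> served x i j \<le> 1) \<and>
                     (\<forall>j. (\<Sum>i\<in>UNIV. served x i j) \<le> 1)}"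

definition service_rate :: "2 \<Rightarrow> 2 \<Rightarrow> real" where
  "service_rate i j = (if i = j then 1 else \<mu>)"

definition released :: "state \<Rightarrow> 2 \<Rightarrow> real" where
  "released x j = (\<Sum>i\<in>UNIV. service_rate i j * served x i j)"

definition gap :: "2 \<Rightarrow> 2 \<Rightarrow> state \<Rightarrow> real" where
  "gap i j x = queue x i - queue x j - \<kappa>"

definition sliding_manifold :: "2 \<Rightarrow> 2 \<Rightarrow> state set" where
  "sliding_manifold i j = {x \<in> state_space. gap i j x = 0 \<and> (\<forall>k. pool_full x k)}"

text \<open>The control is described by a matrix \<open>a\<close> of flow rates: \<open>a $ i $ j\<close> is the rate at which
  class-\<open>i\<close> fluid enters service in pool \<open>j\<close>, either from queue \<open>i\<close> or directly on arrival.\<close>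

definition drift :: "state \<Rightarrow> real^2^2 \<Rightarrow> state" where
  "drift x a = ((\<chi> i. lam - \<theta> * queue x i - (\<Sum>j\<in>UNIV. a $ i $ j)),
                (\<chi> i j. a $ i $ j - service_rate i j * served x i j))"

definition active_sharing :: "2 \<Rightarrow> 2 \<Rightarrow> state \<Rightarrow> bool" where
  "active_sharing i j x \<longleftrightarrow> (\<forall>k. pool_full x k) \<and> gap i j x > 0 \<and> served x j i \<le> \<tau>"

definition sliding :: "2 \<Rightarrow> 2 \<Rightarrow> state \<Rightarrow> bool" where
  "sliding i j x \<longleftrightarrow> x \<in> sliding_manifold i j \<and> served x j i \<le> \<tau>"

text \<open>The admissible assignments while sliding. An empty queue \<open>j\<close> can supply class-\<open>j\<close> fluid
  at most at the arrival rate.\<close>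

definition splits :: "2 \<Rightarrow> 2 \<Rightarrow> state \<Rightarrow> real^2^2 \<Rightarrow> bool" where
  "splits i j x a \<longleftrightarrow>
     a $ i $ i = released x i \<and> a $ j $ i = 0 \<and>
     0 \<le> a $ i $ j \<and> 0 \<le> a $ j $ j \<and> a $ i $ j + a $ j $ j = released x j \<and>
     (queue x j = 0 \<longrightarrow> a $ j $ j \<le> lam)"

definition gap_rate :: "2 \<Rightarrow> 2 \<Rightarrow> state \<Rightarrow> real^2^2 \<Rightarrow> real" where
  "gap_rate i j x a = queue (drift x a) i - queue (drift x a) j"

definition can_absorb :: "state \<Rightarrow> 2 \<Rightarrow> bool" where
  "can_absorb x j \<longleftrightarrow> queue x j = 0 \<and> (\<not> pool_full x j \<or> lam \<le> released x j)"

definition active_rule :: "2 \<Rightarrow> 2 \<Rightarrow> state \<Rightarrow> real^2^2 \<Rightarrow> bool" where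
  "active_rule i j x a \<longleftrightarrow>
     a $ i $ i = released x i \<and> a $ i $ j = released x j \<and> a $ j $ i = 0 \<and> a $ j $ j = 0"

definition sliding_rule :: "2 \<Rightarrow> 2 \<Rightarrow> state \<Rightarrow> real^2^2 \<Rightarrow> bool" where
  "sliding_rule i j x a \<longleftrightarrow>
     splits i j x a \<and>
     ((\<exists>b. splits i j x b \<and> gap_rate i j x b = 0) \<longrightarrow> gap_rate i j x a = 0)"

text \<open>How pool \<open>j\<close> treats its own class \<open>j\<close> and the other class \<open>i\<close> when it is neither actively
  helping class \<open>i\<close> nor splitting its capacity on the sliding manifold. Class-\<open>j\<close> fluid is served
  first: with a positive queue \<open>j\<close> it takes all released capacity, and with an empty queue it is
  absorbed on arrival if possible. So class \<open>j\<close> has strict priority here, and class \<open>i\<close> may only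
  use what class \<open>j\<close> leaves idle, and only if queue \<open>i\<close> has reached \<open>\<kappa>\<close>.

  In that last case, while pool \<open>j\<close> is not full it takes at least the class-\<open>i\<close> fluid that pool
  \<open>i\<close> cannot, so queue \<open>i\<close> does not grow; and while queue \<open>i\<close> exceeds \<open>\<kappa>\<close>, pool \<open>j\<close> leaves no
  released capacity unassigned. The case where pool \<open>j\<close> is full but releases more than class \<open>j\<close>
  needs is included because otherwise no trajectory could keep pool \<open>j\<close> full by taking the
  surplus from queue \<open>i\<close>.\<close>

definition own_rule :: "2 \<Rightarrow> 2 \<Rightarrow> state \<Rightarrow> real^2^2 \<Rightarrow> bool" where
  "own_rule i j x a \<longleftrightarrow>
     a $ j $ j = (if can_absorb x j then lam else released x j) \<and>
     (if can_absorb x j \<and> \<kappa> \<le> queue x i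
      then (\<not> pool_full x j \<longrightarrow> queue (drift x a) i \<le> 0) \<and>
           (\<kappa> < queue x i \<longrightarrow> released x j \<le> a $ i $ j + a $ j $ j)
      else a $ i $ j = 0)"

definition control :: "state \<Rightarrow> real^2^2 \<Rightarrow> bool" where
  "control x a \<longleftrightarrow>
     (\<forall>i j. 0 \<le> a $ i $ j) \<and>
     (\<forall>i j. i \<noteq> j \<longrightarrow>
        (if active_sharing i j x then active_rule i j x a
         else if sliding i j x then sliding_rule i j x a
         else own_rule i j x a))"

text \<open>A trajectory is an integral of its almost-everywhere derivative; without this, singular
  (Cantor-type) continuous perturbations would satisfy the same differential equations almost
  everywhere. Values of \<open>x\<close> at negative times are irrelevant.\<close>

definition trajectory :: "(real \<Rightarrow> state) \<Rightarrow> bool" where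
  "trajectory x \<longleftrightarrow>
     continuous_on {0..} x \<and>
     (\<forall>t\<ge>0. x t \<in> state_space) \<and>
     (\<forall>t\<ge>0. \<forall>i. 0 < queue (x t) i \<longrightarrow> pool_full (x t) i) \<and>
     (\<exists>a. (\<forall>t\<ge>0. ((\<lambda>s. drift (x s) (a s)) has_integral (x t - x 0)) {0..t}) \<and>
          (AE t in lebesgue. 0 < t \<longrightarrow>
             (x has_vector_derivative drift (x t) (a t)) (at t) \<and> control (x t) (a t)))"

text \<open>The first conjunct excludes initial states from which the model has no trajectory at all
  (e.g. a positive queue at a pool that is not full), which would be stationary vacuously.\<close>

definition stationary :: "state \<Rightarrow> bool" where
  "stationary y \<longleftrightarrow>
     (\<exists>x. trajectory x \<and> x 0 = y) \<and>
     (\<forall>x. trajectory x \<and> x 0 = y \<longrightarrow> (\<forall>t\<ge>0. x t = y))"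

definition stationary_points :: "state set" where
  "stationary_points = {y \<in> state_space. stationary y}"

text \<open>The differential equations of active sharing, and of a pool serving only its own queue, in
  terms of the components of the drift.\<close>

lemma active_sharing_drift:
  assumes "i \<noteq> j" "active_sharing i j x" "control x a"
  shows "queue (drift x a) i = lam - \<theta> * queue x i -
           (served x 1 1 + \<mu> * served x 2 1 + \<mu> * served x 1 2 + served x 2 2)"
    and "queue (drift x a) j = lam - \<theta> * queue x j"
    and "served (drift x a) j j = - served x j j"
    and "served x i j = 1 - served x j j"
    and "served (drift x a) j i = - \<mu> * served x j i"
    and "served x i i = 1 - served x j i"
proof -
  have r: "active_rule i j x a" using assms unfolding control_def by metis
  have f: "\<And>k. pool_full x k" using assms(2) unfolding active_sharing_def by blast
  have ij: "i = 1 \<and> j = 2 \<or> i = 2 \<and> j = 1" using assms(1) exhaust_2 by metis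
  note defs = drift_def active_rule_def released_def service_rate_def sum_2
  show "queue (drift x a) i = lam - \<theta> * queue x i -
           (served x 1 1 + \<mu> * served x 2 1 + \<mu> * served x 1 2 + served x 2 2)"
    "queue (drift x a) j = lam - \<theta> * queue x j"
    "served (drift x a) j j = - served x j j"
    "served (drift x a) j i = - \<mu> * served x j i"
    using ij r by (auto simp: defs)
  show "served x i j = 1 - served x j j" "served x i i = 1 - served x j i"
    using ij f[of 1] f[of 2] by (auto simp: pool_full_def sum_2)
qed

lemma no_sharing_drift:
  assumes "\<And>k. pool_full x k" "\<And>i j. i \<noteq> j \<Longrightarrow> gap i j x < 0 \<or> served x j i > \<tau>"
    and "\<And>i. queue x i > 0" and "i \<noteq> j" "control x a"
  shows "queue (drift x a) i = lam - \<theta> * queue x i - served x i i - \<mu> * served x j i"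
    and "served (drift x a) j i = - \<mu> * served x j i"
    and "served x i i = 1 - served x j i"
proof -
  have n: "\<not> active_sharing k l x" "\<not> sliding k l x" if "k \<noteq> l" for k l
    using assms(2)[OF that] unfolding active_sharing_def sliding_def sliding_manifold_def by auto
  have r: "own_rule i j x a" "own_rule j i x a"
    using assms(4,5) n unfolding control_def by metis+
  have c: "\<not> can_absorb x k" for k
    using assms(3)[of k] unfolding can_absorb_def by simp
  have ij: "i = 1 \<and> j = 2 \<or> i = 2 \<and> j = 1" using assms(4) exhaust_2 by metis
  note defs = drift_def own_rule_def released_def service_rate_def sum_2
  show "queue (drift x a) i = lam - \<theta> * queue x i - served x i i - \<mu> * served x j i"
    "served (drift x a) j i = - \<mu> * served x j i"
    using ij r c by (auto simp: defs)
  show "served x i i = 1 - served x j i"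
    using ij assms(1)[of 1] assms(1)[of 2] by (auto simp: pool_full_def sum_2)
qed

end

end

theory Submission
  imports Defs
begin

text \<open>At a stationary point the constant path is a trajectory, so some admissible control
  makes the drift vanish (\<open>stationary_balanced_control\<close>). Balance then says that
  class \<open>i\<close> leaves service at rate
  \<open>lam - \<theta> * queue x i \<le> lam < 1\<close>. Sharing cannot be in equilibrium: the pool of the class being
  helped admits nothing of the other class and is full, so it would hold one unit of its own class
  and serve it at rate \<open>1\<close>. Hence each pool treats its own class with priority, and the same bound
  shows that it absorbs all arrivals of that class; balance then fixes the remaining coordinates
  (\<open>balanced_control_imp_equilibrium\<close>).

  Conversely, the pools are not full at the candidate point. While this lasts, both queues stay
  empty, the control is forced, and every service coordinate \<open>u\<close> of the deviation from the candidate
  obeys \<open>u' = - r * u\<close> and starts at zero, hence stays zero. If some pool ever became full, then at the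
  first such time the state would, by continuity, still be the candidate, whose pools are not full
  (\<open>trajectory_from_equilibrium\<close>).\<close>

section \<open>Linear decay and null sets\<close>

text \<open>The integral equation makes \<open>u\<close> differentiable everywhere, so the integrating factor
  \<open>exp (r * t)\<close> applies; an almost-everywhere derivative would not determine \<open>u\<close>.\<close>

lemma linear_decay_from_zero:
  fixes u :: "real \<Rightarrow> real"
  assumes "continuous_on {0..T} u"
    and int: "\<And>t. t \<in> {0..T} \<Longrightarrow> ((\<lambda>s. - r * u s) has_integral u t) {0..t}"
    and "t \<in> {0..T}"
  shows "u t = 0"
proof -
  have u0: "u 0 = 0"
    using int[of 0] assms(3) by (auto simp: has_integral_refl(2) dest: has_integral_unique)
  have der: "(u has_real_derivative - r * u s) (at s within {0..T})" if s: "s \<in> {0..T}" for s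
  proof -
    have "((\<lambda>v. integral {0..v} (\<lambda>w. - r * u w)) has_vector_derivative - r * u s)
            (at s within {0..T})"
      by (rule integral_has_vector_derivative) (intro continuous_intros assms(1) s)+
    then have "(u has_vector_derivative - r * u s) (at s within {0..T})"
      by (rule has_vector_derivative_transform[OF s, rotated])
        (rule integral_unique[OF int, symmetric])
    then show ?thesis
      by (simp add: has_real_derivative_iff_has_vector_derivative)
  qed
  have "\<exists>c. \<forall>s\<in>{0..T}. u s * exp (r * s) = c"
  proof (rule has_field_derivative_zero_constant)
    show "((\<lambda>s. u s * exp (r * s)) has_field_derivative 0) (at s within {0..T})"
      if "s \<in> {0..T}" for s
      by (rule derivative_eq_intros der[OF that] refl)+ (simp add: algebra_simps)
  qed simp
  then obtain c where c: "\<And>s. s \<in> {0..T} \<Longrightarrow> u s * exp (r * s) = c" by blast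
  have "u t * exp (r * t) = 0"
    using c[of 0] c[OF assms(3)] assms(3) u0 by simp
  then show ?thesis by simp
qed

lemma AE_lebesgue_negligibleE:
  assumes "AE t in lebesgue. P t"
  obtains N where "negligible N" "\<And>t. t \<notin> N \<Longrightarrow> P t"
  using assms by (auto simp: eventually_ae_filter negligible_iff_null_sets)

lemma two_index_cases:
  fixes i j :: 2
  assumes "i \<noteq> j"
  shows "i = 1 \<and> j = 2 \<or> i = 2 \<and> j = 1"
  using assms exhaust_2 by metis

context switching_fluid
begin

section \<open>The dynamics near the equilibrium\<close>

definition equilibrium :: state where
  "equilibrium = ((\<chi> i. 0), (\<chi> i j. if i = j then lam else 0))"

lemma equilibrium_eq_vector:
  "equilibrium = (vector [0, 0], vector [vector [lam, 0], vector [0, lam]])"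
  by (simp add: equilibrium_def vec_eq_iff forall_2)

lemma equilibrium_not_full:
  assumes "lam < 1"
  shows "\<not> pool_full equilibrium k"
  using assms exhaust_2[of k] by (auto simp: pool_full_def equilibrium_def sum_2)

text \<open>Below capacity with empty queues the model leaves no choice: sharing requires full pools,
  and \<open>\<kappa> > 0\<close> forbids overflow from an empty queue.\<close>

lemma control_of_slack_pools:
  assumes "0 \<le> lam" "0 < \<kappa>" and nf: "\<And>k. \<not> pool_full x k" and q: "\<And>i. queue x i = 0"
  shows "control x a \<longleftrightarrow> a = (\<chi> i j. if i = j then lam else 0)"
proof -
  have "\<not> active_sharing i j x" "\<not> sliding i j x" "can_absorb x j" for i j
    using nf q by (auto simp: active_sharing_def sliding_def sliding_manifold_def can_absorb_def)
  then have "control x a \<longleftrightarrow> (\<forall>i j. 0 \<le> a $ i $ j) \<and>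
      (\<forall>i j. i \<noteq> j \<longrightarrow> a $ j $ j = lam \<and> a $ i $ j = 0)"
    using q assms(2) by (simp add: control_def own_rule_def)
  then show ?thesis
    using assms(1) by (auto simp: vec_eq_iff forall_2)
qed

lemma drift_of_slack_control:
  assumes "\<And>i. queue x i = 0"
  shows "queue (drift x (\<chi> i j. if i = j then lam else 0)) i = 0"
    and "served (drift x (\<chi> i j. if i = j then lam else 0)) i j =
           - service_rate i j * (served x i j - served equilibrium i j)"
  using assms exhaust_2[of i]
  by (auto simp: drift_def equilibrium_def service_rate_def sum_2 algebra_simps)

text \<open>While no pool is full, the work-conservation clause of \<open>trajectory\<close> keeps the queues
  empty, so the integral equation is a decoupled linear system for the deviation from
  equilibrium. Fullness is allowed at the final time \<open>T\<close>, a null set; this is what rules out a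
  first time at which a pool becomes full.\<close>

lemma trajectory_while_slack:
  assumes "0 \<le> lam" "0 < \<kappa>"
    and x: "trajectory x" "x 0 = equilibrium"
    and nf: "\<And>t k. 0 \<le> t \<Longrightarrow> t < T \<Longrightarrow> \<not> pool_full (x t) k"
    and t: "t \<in> {0..T}"
  shows "x t = equilibrium"
proof -
  obtain a where
    int: "\<And>t. 0 \<le> t \<Longrightarrow> ((\<lambda>s. drift (x s) (a s)) has_integral (x t - x 0)) {0..t}" and
    ae: "AE t in lebesgue. 0 < t \<longrightarrow>
      (x has_vector_derivative drift (x t) (a t)) (at t) \<and> control (x t) (a t)"
    using x(1) unfolding trajectory_def by blast
  have contx: "continuous_on {0..T} x"
    using x(1) by (auto simp: trajectory_def intro: continuous_on_subset)
  have q0: "queue (x s) i = 0" if "0 \<le> s" "s < T" for s i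
  proof -
    have "x s \<in> state_space" "\<not> 0 < queue (x s) i"
      using x(1) nf[OF that, of i] that(1) unfolding trajectory_def by blast+
    then show ?thesis
      unfolding state_space_def by (simp add: order.antisym)
  qed
  obtain N where N: "negligible N"
    and ctl: "\<And>s. 0 < s \<Longrightarrow> s \<notin> N \<Longrightarrow> control (x s) (a s)"
    using AE_lebesgue_negligibleE[OF ae] by metis
  have "negligible (N \<union> {0, T})"
    using N by simp
  let ?u = "\<chi> i j. if i = j then lam else (0::real)"
  have a_eq: "a s = ?u" if "s \<in> {0..T} - (N \<union> {0, T})" for s
    using control_of_slack_pools[OF assms(1,2), of "x s" "a s"] nf[of s] q0[of s] ctl[of s] that
    by auto
  (* A linear functional of the path integrates the same functional of the forced drift. *)
  have comp: "((\<lambda>s. f (drift (x s) ?u)) has_integral f (x t) - f equilibrium) {0..t}"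
    if f: "bounded_linear f" and t: "t \<in> {0..T}" for f :: "state \<Rightarrow> real" and t
  proof -
    have "((\<lambda>s. f (drift (x s) (a s))) has_integral f (x t - x 0)) {0..t}"
      using has_integral_linear[OF int f, of t] t by (simp add: o_def)
    then have "((\<lambda>s. f (drift (x s) ?u)) has_integral f (x t - x 0)) {0..t}"
      by (rule has_integral_spike[OF \<open>negligible (N \<union> {0, T})\<close>, rotated])
        (use a_eq t in auto)
    then show ?thesis
      using x(2) by (simp add: bounded_linear.linear[OF f] linear_diff)
  qed
  (* The queues are known to be empty only before T, so the time T itself is discarded. *)
  have spike: "(g has_integral c) {0..t}"
    if "(f has_integral c) {0..t}" "\<And>s. 0 \<le> s \<Longrightarrow> s < T \<Longrightarrow> g s = f s" "t \<in> {0..T}"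
    for f g :: "real \<Rightarrow> real" and c t
    by (rule has_integral_spike[OF negligible_sing[of T] _ that(1)]) (use that in auto)
  have "queue (x t) i = queue equilibrium i" for i
  proof -
    have "bounded_linear (\<lambda>y::state. queue y i)"
      by (intro bounded_linear_compose[OF bounded_linear_vec_nth] bounded_linear_fst)
    from comp[OF this t] have "((\<lambda>s. 0) has_integral queue (x t) i - queue equilibrium i) {0..t}"
      by (rule spike) (use q0 drift_of_slack_control(1) t in auto)
    then show ?thesis
      using has_integral_0 has_integral_unique by fastforce
  qed
  moreover have "served (x t) i j = served equilibrium i j" for i j
  proof -
    have bl: "bounded_linear (\<lambda>y::state. served y i j)"
      by (intro bounded_linear_compose[OF bounded_linear_vec_nth]
          bounded_linear_compose[OF bounded_linear_vec_nth] bounded_linear_snd)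
    have "served (x t) i j - served equilibrium i j = 0"
    proof (rule linear_decay_from_zero[OF _ _ t])
      show "continuous_on {0..T} (\<lambda>t. served (x t) i j - served equilibrium i j)"
        by (intro continuous_intros contx)
      show "((\<lambda>s. - service_rate i j * (served (x s) i j - served equilibrium i j)) has_integral
          served (x v) i j - served equilibrium i j) {0..v}" if "v \<in> {0..T}" for v
        by (rule spike[OF comp[OF bl that] _ that])
          (use q0 drift_of_slack_control(2) in metis)
    qed
    then show ?thesis by simp
  qed
  ultimately show ?thesis
    by (simp add: prod_eq_iff vec_eq_iff)
qed

lemma trajectory_from_equilibrium:
  assumes "0 \<le> lam" "lam < 1" "0 < \<kappa>"
    and x: "trajectory x" "x 0 = equilibrium" and "0 \<le> t"
  shows "x t = equilibrium"
proof -
  define F where "F = (\<Union>k. {s \<in> {0..t}. (\<Sum>i\<in>UNIV. served (x s) i k) = 1})"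
  have F_iff: "s \<in> F \<longleftrightarrow> s \<in> {0..t} \<and> (\<exists>k. pool_full (x s) k)" for s
    by (auto simp: F_def pool_full_def)
  have contx: "continuous_on {0..t} x"
    using x(1) by (auto simp: trajectory_def intro: continuous_on_subset)
  have "closed F"
    unfolding F_def
    by (intro closed_UN ballI continuous_closed_preimage_constant continuous_intros contx
        finite closed_atLeastAtMost)
  moreover have "F \<subseteq> {0..t}" by (auto simp: F_def)
  ultimately have "compact F"
    using compact_Int_closed[OF compact_Icc, of F 0 t] by (simp add: Int_absorb1)
  have "F = {}"
  proof (rule ccontr)
    assume "F \<noteq> {}"
    then obtain m where m: "m \<in> F" "\<And>s. s \<in> F \<Longrightarrow> m \<le> s"
      using compact_attains_inf[OF \<open>compact F\<close>] by blast
    have "x m = equilibrium"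
      by (rule trajectory_while_slack[OF assms(1,3) x, of m]) (use m F_iff in force)+
    then show False
      using m(1) F_iff equilibrium_not_full[OF assms(2)] by simp
  qed
  then show ?thesis
    by (intro trajectory_while_slack[OF assms(1,3) x, of t]) (use F_iff assms(6) in force)+
qed

lemma equilibrium_stationary:
  assumes "0 \<le> lam" "lam < 1" "0 < \<theta>" "0 < \<kappa>"
  shows "equilibrium \<in> stationary_points"
proof -
  let ?u = "\<chi> i j. if i = j then lam else (0::real)"
  have mem: "equilibrium \<in> state_space"
    using assms by (auto simp: state_space_def equilibrium_def sum_2 forall_2)
  have q: "queue equilibrium i = 0" for i
    by (simp add: equilibrium_def)
  have "drift equilibrium ?u = 0"
    using drift_of_slack_control[OF q]
    by (simp add: prod_eq_iff vec_eq_iff zero_prod_def)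
  moreover have "control equilibrium ?u"
    using control_of_slack_pools[OF assms(1,4) equilibrium_not_full[OF assms(2)] q] by simp
  ultimately have "trajectory (\<lambda>_. equilibrium)"
    unfolding trajectory_def using mem q by (auto intro!: exI[of _ "\<lambda>_. ?u"])
  then show ?thesis
    using mem trajectory_from_equilibrium[OF assms(1,2,4)]
    unfolding stationary_points_def stationary_def by blast
qed

section \<open>Balance at a stationary point\<close>

text \<open>The differential equation holds only almost everywhere, but a constant path has derivative
  zero at all positive times, and one good time suffices.\<close>

lemma stationary_balanced_control:
  assumes "stationary y"
  obtains a where "drift y a = 0" "control y a" "\<And>i. 0 < queue y i \<Longrightarrow> pool_full y i"
proof -
  obtain x where x: "trajectory x" "x 0 = y" "\<And>t. 0 \<le> t \<Longrightarrow> x t = y"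
    using assms unfolding stationary_def by blast
  obtain a where ae: "AE t in lebesgue. 0 < t \<longrightarrow>
      (x has_vector_derivative drift (x t) (a t)) (at t) \<and> control (x t) (a t)"
    using x(1) unfolding trajectory_def by blast
  obtain N where N: "negligible N" and
    a: "\<And>t. 0 < t \<Longrightarrow> t \<notin> N \<Longrightarrow>
      (x has_vector_derivative drift (x t) (a t)) (at t) \<and> control (x t) (a t)"
    using AE_lebesgue_negligibleE[OF ae] by metis
  then have "\<not> {0<..<1::real} \<subseteq> N"
    using negligible_subset[of N "{0<..<1}"] negligible_interval(2)[of "0::real" 1] by auto
  then obtain t where t: "0 < t" "t \<notin> N"
    by (meson greaterThanLessThan_iff subsetI)
  have "(x has_vector_derivative 0) (at t)"
    by (rule has_vector_derivative_transform_within_open[of "\<lambda>_. y" _ _ "{0<..}"])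
      (use t x(3) in auto)
  then have "drift y (a t) = 0"
    using a[OF t] x(3)[of t] t(1) vector_derivative_unique_at[of x _ t 0] by simp
  then show ?thesis
    using that[of "a t"] a[OF t] x(1,2) x(3)[of t] t(1) unfolding trajectory_def by auto
qed

text \<open>Since \<open>served y i i \<le> lam < 1\<close> by balance, no pool can be full of its own class alone.
  That excludes sharing and sliding, which demand full pools and admit no fluid of the other class
  to the pool of the helped class. It also excludes a pool that cannot absorb its own class: such a
  pool is full and gives all released capacity to its own class.\<close>

lemma balanced_control_imp_equilibrium:
  assumes "0 < lam" "lam < 1" "0 < \<mu>" "0 \<le> \<theta>"
    and y: "y \<in> state_space" and work: "\<And>i. 0 < queue y i \<Longrightarrow> pool_full y i"
    and a: "drift y a = 0" "control y a"
  shows "y = equilibrium"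
proof -
  have nn: "0 \<le> queue y i" "0 \<le> served y i j" for i j
    using y by (auto simp: state_space_def)
  have inflow: "a $ i $ j = service_rate i j * served y i j" for i j
    using a(1) by (simp add: drift_def prod_eq_iff vec_eq_iff)
  have balance: "served y i i + \<mu> * served y i j = lam - \<theta> * queue y i" if "i \<noteq> j" for i j
  proof -
    have "(\<Sum>j\<in>UNIV. a $ i $ j) = lam - \<theta> * queue y i"
      using a(1) by (simp add: drift_def prod_eq_iff vec_eq_iff)
    then show ?thesis
      using two_index_cases[OF that] by (auto simp: inflow service_rate_def sum_2)
  qed
  have own_lt: "served y i i < 1" for i
  proof -
    obtain j where "i \<noteq> j" by (metis (full_types) zero_neq_one)
    moreover have "0 \<le> \<mu> * served y i j" "0 \<le> \<theta> * queue y i"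
      using nn assms by auto
    ultimately show ?thesis using balance[of i j] assms(2) by linarith
  qed
  have not_full: "\<not> pool_full y i" if "i \<noteq> j" "served y j i = 0" for i j
    using two_index_cases[OF that(1)] that(2) own_lt[of i]
    by (auto simp: pool_full_def sum_2)
  have other: "served y j i = 0" if "i \<noteq> j" "a $ j $ i = 0" for i j
    using inflow[of j i] that assms(3) by (simp add: service_rate_def)
  have own: "own_rule i j y a" if ij: "i \<noteq> j" for i j
  proof -
    have "\<not> active_sharing i j y"
    proof
      assume s: "active_sharing i j y"
      then have "active_rule i j y a" using a(2) ij unfolding control_def by metis
      then show False
        using s not_full[OF ij] other[OF ij]
        by (auto simp: active_rule_def active_sharing_def)
    qed
    moreover have "\<not> sliding i j y"
    proof
      assume s: "sliding i j y"
      then have "sliding_rule i j y a"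
        using a(2) ij \<open>\<not> active_sharing i j y\<close> unfolding control_def by metis
      then show False
        using s not_full[OF ij] other[OF ij]
        by (auto simp: sliding_rule_def splits_def sliding_def sliding_manifold_def)
    qed
    ultimately show ?thesis using a(2) ij unfolding control_def by metis
  qed
  have absorbed: "can_absorb y j" if ij: "i \<noteq> j" for i j
  proof (rule ccontr)
    assume n: "\<not> can_absorb y j"
    then have "a $ j $ j = released y j"
      using own[OF ij] by (simp add: own_rule_def)
    then have "served y i j = 0"
      using inflow[of j j] two_index_cases[OF ij] assms(3)
      by (auto simp: released_def service_rate_def sum_2)
    then have "\<not> pool_full y j" using not_full[of j i] ij by blast
    then show False
      using n work[of j] nn(1)[of j] by (auto simp: can_absorb_def)
  qed
  have q: "queue y j = 0" and own_eq: "served y j j = lam" and other_eq: "served y j i = 0"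
    if ij: "i \<noteq> j" for i j
  proof -
    show q: "queue y j = 0" using absorbed[OF ij] by (simp add: can_absorb_def)
    show s: "served y j j = lam"
      using own[OF ij] absorbed[OF ij] inflow[of j j]
      by (simp add: own_rule_def service_rate_def)
    show "served y j i = 0"
      using balance[of j i] ij q s assms(3) by simp
  qed
  have "queue y j = queue equilibrium j \<and> served y j i = served equilibrium j i" for i j
  proof (cases "i = j")
    case True
    obtain k where "k \<noteq> j" by (metis (full_types) zero_neq_one)
    then show ?thesis using True q own_eq by (simp add: equilibrium_def)
  next
    case False
    then show ?thesis using q other_eq by (simp add: equilibrium_def)
  qed
  then show ?thesis by (simp add: prod_eq_iff vec_eq_iff)
qed

end

theorem theorem5p2:
  fixes lam \<mu> \<theta> \<kappa> \<tau> :: real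
  assumes "0 < lam" "lam < 1" "0 < \<mu>" "\<mu> < 1" "\<theta> > 0" "\<kappa> > 0" "\<tau> > 0"
    and "lam \<le> 1 - \<tau>" and "\<theta> < \<mu>"
  shows "switching_fluid.stationary_points lam \<mu> \<theta> \<kappa> \<tau> =
           {(vector [0, 0], vector [vector [lam, 0], vector [0, lam]])}"
proof -
  interpret switching_fluid lam \<mu> \<theta> \<kappa> \<tau> .
  have "y = equilibrium" if "y \<in> stationary_points" for y
  proof -
    have y: "y \<in> state_space" "stationary y"
      using that by (auto simp: stationary_points_def)
    obtain a where "drift y a = 0" "control y a" "\<And>i. 0 < queue y i \<Longrightarrow> pool_full y i"
      using stationary_balanced_control[OF y(2)] by metis
    then show ?thesis
      using balanced_control_imp_equilibrium[of y a] y(1) assms by simp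
  qed
  then have "stationary_points = {equilibrium}"
    using equilibrium_stationary[OF less_imp_le[OF assms(1)] assms(2,5,6)] by blast
  then show ?thesis by (simp add: equilibrium_eq_vector)
qed

end
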